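(* Let $G=(S,T,\pi)$ be a two-person win-lose game (with $S,T$ arbitrary non-empty sets). Then $G$ is totally minimax if and only if $G$ is LNG-free.
   Context: A two-person win-lose game is a triple $G=(S,T,\pi)$ where $S,T$ are non-empty sets (possibly infinite, of any cardinality) and $\pi:S\times T\to\{0,1\}$. For a set $X$, $\Delta(X)$ denotes the set of probability distributions $\mathbf{p}=(p_x)_{x\in X}$ on $X$ with at most countable support. For $\mathbf{p}\in\Delta(S)$, $\mathbf{q}\in\Delta(T)$, $\pi^{\mathrm{mix}}(\mathbf{p},\mathbf{q})=\sum_{s,t}p_sq_t\pi(s,t)$. $G$ satisfies the minimax property if $\sup_{\mathbf{p}\in\Delta(S)}\inf_{\mathbf{q}\in\Delta(T)}\pi^{\mathrm{mix}}(\mathbf{p},\mathbf{q})=\inf_{\mathbf{q}\in\Delta(T)}\sup_{\mathbf{p}\in\Delta(S)}\pi^{\mathrm{mix}}(\mathbf{p},\mathbf{q})$. A subgame of $G$ is a game $(S',T',\pi')$ with non-empty $S'\subseteq S$, $T'\subseteq T$ and $\pi'=\pi|_{S'\times T'}$. $G$ is totally minimax if every subgame of $G$ satisfies the minimax property. The larger number game (LNG) is $(\mathbb{N},\mathbb{N},\pi)$ with $\pi(s,t)=1$ iff $s\ge t$. $G$ is LNG-free if no subgame of $G$ is isomorphic to LNG, i.e., there are no sequences $s_1,s_2,\ldots$ in $S$ and $t_1,t_2,\ldots$ in $T$ (each consisting of distinct elements) with $\pi(s_i,t_j)=1\iff i\ge j$. *)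

theory Defs
  imports "HOL-Analysis.Analysis"
begin

text \<open>A win-lose game is given by strategy sets S, T and a payoff relation
  \<pi> :: 'a \<Rightarrow> 'b \<Rightarrow> bool (True = payoff 1, False = payoff 0).\<close>

definition distr :: "'a set \<Rightarrow> ('a \<Rightarrow> real) set" where
  "distr X = {p. (\<forall>x. 0 \<le> p x) \<and> (\<forall>x. x \<notin> X \<longrightarrow> p x = 0)
                 \<and> countable {x. p x \<noteq> 0} \<and> (p has_sum 1) X}"

definition mix :: "('a \<Rightarrow> 'b \<Rightarrow> bool) \<Rightarrow> 'a set \<Rightarrow> 'b set \<Rightarrow> ('a \<Rightarrow> real) \<Rightarrow> ('b \<Rightarrow> real) \<Rightarrow> real" where
  "mix \<pi> S T p q = (\<Sum>\<^sub>\<infinity>(s,t)\<in>S \<times> T. p s * q t * of_bool (\<pi> s t))"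

definition minimax_property :: "'a set \<Rightarrow> 'b set \<Rightarrow> ('a \<Rightarrow> 'b \<Rightarrow> bool) \<Rightarrow> bool" where
  "minimax_property S T \<pi> \<longleftrightarrow>
     (SUP p\<in>distr S. INF q\<in>distr T. mix \<pi> S T p q) =
     (INF q\<in>distr T. SUP p\<in>distr S. mix \<pi> S T p q)"

definition totally_minimax :: "'a set \<Rightarrow> 'b set \<Rightarrow> ('a \<Rightarrow> 'b \<Rightarrow> bool) \<Rightarrow> bool" where
  "totally_minimax S T \<pi> \<longleftrightarrow>
     (\<forall>S' T'. S' \<noteq> {} \<longrightarrow> S' \<subseteq> S \<longrightarrow> T' \<noteq> {} \<longrightarrow> T' \<subseteq> T \<longrightarrow> minimax_property S' T' \<pi>)"

definition LNG_free :: "'a set \<Rightarrow> 'b set \<Rightarrow> ('a \<Rightarrow> 'b \<Rightarrow> bool) \<Rightarrow> bool" where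
  "LNG_free S T \<pi> \<longleftrightarrow>
     \<not> (\<exists>s :: nat \<Rightarrow> 'a. \<exists>t :: nat \<Rightarrow> 'b. inj s \<and> inj t \<and> range s \<subseteq> S \<and> range t \<subseteq> T \<and>
           (\<forall>i j. \<pi> (s i) (t j) \<longleftrightarrow> j \<le> i))"

end

theory Submission
  imports Defs
begin

text \<open>
  The hard direction bounds the upper value by the lower value for an LNG-free game. First, suppose
  every finite set of rows is beaten by a single column. Call a set of rows null if, even using only
  columns that beat a prescribed finite set of rows, some mixed column holds all its rows to at most
  \<open>\<epsilon>\<close>. A non-null set stays non-null when it is cut down to the rows that win against some column of
  a suitable finite set; iterating this and applying Koenig's lemma produces the larger number game.
  Hence the upper value is 0.

  In general, pass to a countable subgame. By compactness, the mixed columns that are optimal against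
  finite sets of rows have a limit \<open>l\<close>, a finitely additive probability on columns with
  \<open>l {t. \<pi> s t} \<le> a\<close> for all rows \<open>s\<close>. Enumerate the uniform distributions \<open>Q k\<close> on finite lists of
  columns. By the value 0 case, the columns are covered by finitely many sets on which \<open>Q k\<close> is, up to
  an \<open>l\<close>-small error, dominated by the column itself plus \<open>\<epsilon>\<close>; replacing each column by the
  corresponding \<open>Q k\<close> turns \<open>l\<close> into a genuine mixed column with almost the same guarantees.
\<close>

subsection \<open>Mixed columns as finite lists\<close>

text \<open>The payoff of a row with winning columns \<open>P\<close> against the uniform mixture of
  the entries of \<open>ts\<close>. With lists, mixing is concatenation, and countably many columns
  yield only countably many mixtures. The empty list gets the default value 0, hence the recurring
  \<open>ts \<noteq> []\<close>.\<close>

definition freq :: "('b \<Rightarrow> bool) \<Rightarrow> 'b list \<Rightarrow> real" where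
  "freq P ts = real (length (filter P ts)) / real (length ts)"

lemma freq_nonneg: "0 \<le> freq P ts"
  by (simp add: freq_def)

lemma freq_le_1: "freq P ts \<le> 1"
  by (simp add: freq_def divide_le_eq)

text \<open>Real weights are rounded up to integer multiplicities of the lists \<open>Q i\<close>.
  In a long concatenation the rounding costs at most \<open>\<delta>\<close>, uniformly in
  \<open>P\<close>.\<close>

lemma freq_mixture:
  fixes \<nu> :: "nat \<Rightarrow> real" and Q :: "nat \<Rightarrow> 'b list"
  assumes \<nu>: "\<And>i. i < n \<Longrightarrow> 0 \<le> \<nu> i" "(\<Sum>i<n. \<nu> i) = 1"
    and Q: "\<And>i. i < n \<Longrightarrow> Q i \<noteq> []" "\<And>i. i < n \<Longrightarrow> set (Q i) \<subseteq> T"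
    and "0 < \<delta>"
  obtains ts where "ts \<noteq> []" "set ts \<subseteq> T"
    "\<And>P. freq P ts \<le> (\<Sum>i<n. \<nu> i * freq P (Q i)) + \<delta>"
proof -
  define L where "L = (\<Sum>i<n. length (Q i))"
  obtain N0 :: nat where N0: "real L / \<delta> < real N0"
    using reals_Archimedean2 by blast
  define N where "N = Suc N0"
  have N: "0 < N" "real L \<le> \<delta> * N"
    using N0 \<open>0 < \<delta>\<close> by (auto simp: N_def field_simps)
  \<comment> \<open>Enough copies of \<open>Q i\<close> to fill \<open>N * \<nu> i\<close>
    positions; rounding up adds less than one copy each, so at most \<open>L\<close> positions in
    all.\<close>
  define m where "m i = nat \<lceil>N * \<nu> i / length (Q i)\<rceil>" for i
  have "\<exists>ts. set ts \<subseteq> T \<and> (\<forall>P. length (filter P ts) = (\<Sum>i<k. m i * length (filter P (Q i))))"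
    if "k \<le> n" for k
    using that
  proof (induction k)
    case 0
    show ?case by (intro exI[of _ "[]"]) simp
  next
    case (Suc k)
    then obtain ts where ts: "set ts \<subseteq> T"
      "\<And>P. length (filter P ts) = (\<Sum>i<k. m i * length (filter P (Q i)))"
      by auto
    have "length (filter P (concat (replicate j (Q k)))) = j * length (filter P (Q k))" for P j
      by (induction j) auto
    then show ?case
      using ts Q(2)[of k] Suc.prems
      by (intro exI[of _ "ts @ concat (replicate (m k) (Q k))"]) auto
  qed
  from this[OF order.refl] obtain ts where ts: "set ts \<subseteq> T"
    "\<And>P. length (filter P ts) = (\<Sum>i<n. m i * length (filter P (Q i)))"
    by blast
  have len: "length ts = (\<Sum>i<n. m i * length (Q i))"
    using ts(2)[of "\<lambda>_. True"] by simp
  have m_ge: "N * \<nu> i \<le> m i * length (Q i)" if "i < n" for i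
  proof -
    have "N * \<nu> i / length (Q i) \<le> m i"
      unfolding m_def by linarith
    then show ?thesis using Q(1)[OF that] by (simp add: field_simps)
  qed
  have m_le: "m i \<le> N * \<nu> i / length (Q i) + 1" if "i < n" for i
  proof -
    have "0 \<le> N * \<nu> i / length (Q i)" using \<nu>(1)[OF that] by simp
    then show ?thesis unfolding m_def by linarith
  qed
  have "real N = (\<Sum>i<n. N * \<nu> i)"
    by (simp add: \<nu>(2) flip: sum_distrib_left)
  also have "\<dots> \<le> (\<Sum>i<n. real (m i * length (Q i)))"
    using m_ge by (intro sum_mono) auto
  also have "\<dots> = length ts" by (simp add: len)
  finally have N_le: "real N \<le> length ts" .
  have "freq P ts \<le> (\<Sum>i<n. \<nu> i * freq P (Q i)) + \<delta>" for P
  proof -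
    have "real (length (filter P ts)) = (\<Sum>i<n. real (m i) * length (filter P (Q i)))"
      by (simp add: ts(2))
    also have "\<dots> \<le> (\<Sum>i<n. N * (\<nu> i * freq P (Q i)) + length (Q i))"
    proof (intro sum_mono)
      fix i assume "i \<in> {..<n}"
      then have "real (m i) * length (filter P (Q i))
          \<le> (N * \<nu> i / length (Q i) + 1) * length (filter P (Q i))"
        using m_le by (intro mult_right_mono) auto
      also have "\<dots> = N * (\<nu> i * freq P (Q i)) + length (filter P (Q i))"
        by (simp add: freq_def distrib_right)
      finally show "real (m i) * length (filter P (Q i)) \<le> N * (\<nu> i * freq P (Q i)) + length (Q i)"
        using length_filter_le[of P "Q i"] by linarith
    qed
    also have "\<dots> = N * (\<Sum>i<n. \<nu> i * freq P (Q i)) + L"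
      by (simp add: sum.distrib sum_distrib_left L_def)
    also have "\<dots> \<le> N * ((\<Sum>i<n. \<nu> i * freq P (Q i)) + \<delta>)"
      using N by (simp add: algebra_simps)
    also have "\<dots> \<le> length ts * ((\<Sum>i<n. \<nu> i * freq P (Q i)) + \<delta>)"
      using N_le \<nu>(1) \<open>0 < \<delta>\<close>
      by (intro mult_right_mono add_nonneg_nonneg sum_nonneg) (auto simp: freq_nonneg)
    finally have "real (length (filter P ts)) \<le> length ts * ((\<Sum>i<n. \<nu> i * freq P (Q i)) + \<delta>)" .
    moreover have "0 < real (length ts)" using N N_le by linarith
    ultimately show ?thesis
      unfolding freq_def[of P ts] by (simp add: pos_divide_le_eq mult.commute)
  qed
  moreover have "ts \<noteq> []" using N N_le by auto
  ultimately show thesis using ts(1) that by blast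
qed

text \<open>Blackwell approachability: answering the positive parts of the accumulated excesses
  keeps their sum of squares linear in the number of rounds.\<close>

lemma finite_rows_minimax:
  fixes \<pi> :: "'a \<Rightarrow> 'b \<Rightarrow> bool"
  assumes "finite B" "T \<noteq> {}" "0 < \<delta>"
    and resp: "\<And>p :: 'a \<Rightarrow> real. (\<And>s. s \<in> B \<Longrightarrow> 0 \<le> p s) \<Longrightarrow> sum p B = 1 \<Longrightarrow>
      \<exists>t\<in>T. (\<Sum>s\<in>B. p s * of_bool (\<pi> s t)) \<le> a"
  shows "\<exists>ts. ts \<noteq> [] \<and> set ts \<subseteq> T \<and> (\<forall>s\<in>B. freq (\<pi> s) ts \<le> a + \<delta>)"
proof -
  \<comment> \<open>\<open>R\<close> is the accumulated excess of a row over the target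
    \<open>a\<close>; \<open>c\<close> bounds the growth per round of the sum of squared positive
    parts.\<close>
  define R where "R s ts = real (length (filter (\<pi> s) ts)) - a * real (length ts)" for s ts
  define c where "c = card B * (1 + \<bar>a\<bar>)\<^sup>2"
  have resp': "\<exists>t\<in>T. (\<Sum>s\<in>B. p s * (of_bool (\<pi> s t) - a)) \<le> 0"
    if p: "\<And>s. s \<in> B \<Longrightarrow> 0 \<le> p s" for p :: "'a \<Rightarrow> real"
  proof (cases "sum p B = 0")
    case True
    then have "\<forall>s\<in>B. p s = 0"
      using p \<open>finite B\<close> by (simp add: sum_nonneg_eq_0_iff)
    then show ?thesis using \<open>T \<noteq> {}\<close> by auto
  next
    case False
    then have pos: "0 < sum p B" using sum_nonneg[of B p] p by fastforce
    obtain t where t: "t \<in> T" "(\<Sum>s\<in>B. p s / sum p B * of_bool (\<pi> s t)) \<le> a"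
      using resp[of "\<lambda>s. p s / sum p B"] p pos by (auto simp flip: sum_divide_distrib)
    have "(\<Sum>s\<in>B. p s * of_bool (\<pi> s t)) / sum p B \<le> a"
      using t(2) unfolding sum_divide_distrib by simp
    then have "(\<Sum>s\<in>B. p s * of_bool (\<pi> s t)) \<le> a * sum p B"
      using pos by (simp add: divide_le_eq)
    then have "(\<Sum>s\<in>B. p s * (of_bool (\<pi> s t) - a)) \<le> 0"
      by (simp add: right_diff_distrib sum_subtractf sum_distrib_left mult.commute)
    then show ?thesis using t(1) by blast
  qed
  have sq: "(max 0 (x + y))\<^sup>2 \<le> (max 0 x)\<^sup>2 + 2 * (max 0 x * y) + y\<^sup>2" for x y :: real
  proof -
    have "(max 0 (x + y))\<^sup>2 \<le> (max 0 x + y)\<^sup>2"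
    proof (cases "x + y \<le> 0")
      case False
      then show ?thesis by (intro power_mono) auto
    qed auto
    then show ?thesis by (simp add: power2_eq_square algebra_simps)
  qed
  have "\<exists>ts. length ts = n \<and> set ts \<subseteq> T \<and> (\<Sum>s\<in>B. (max 0 (R s ts))\<^sup>2) \<le> n * c" for n
  proof (induction n)
    case 0
    show ?case by (intro exI[of _ "[]"]) (simp add: R_def)
  next
    case (Suc n)
    then obtain ts where ts: "length ts = n" "set ts \<subseteq> T" "(\<Sum>s\<in>B. (max 0 (R s ts))\<^sup>2) \<le> n * c"
      by blast
    \<comment> \<open>Answering the current positive parts makes the cross term of the expanded
      square nonpositive.\<close>
    obtain t where t: "t \<in> T" "(\<Sum>s\<in>B. max 0 (R s ts) * (of_bool (\<pi> s t) - a)) \<le> 0"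
      using resp'[of "\<lambda>s. max 0 (R s ts)"] by auto
    have R: "R s (t # ts) = R s ts + (of_bool (\<pi> s t) - a)" for s
      by (simp add: R_def algebra_simps)
    have "(\<Sum>s\<in>B. (max 0 (R s (t # ts)))\<^sup>2) \<le> (\<Sum>s\<in>B. (max 0 (R s ts))\<^sup>2
        + 2 * (max 0 (R s ts) * (of_bool (\<pi> s t) - a)) + (1 + \<bar>a\<bar>)\<^sup>2)"
    proof (intro sum_mono)
      fix s
      have "(of_bool (\<pi> s t) - a)\<^sup>2 \<le> (1 + \<bar>a\<bar>)\<^sup>2"
        by (intro power2_le_iff_abs_le[THEN iffD2]) auto
      then show "(max 0 (R s (t # ts)))\<^sup>2 \<le> (max 0 (R s ts))\<^sup>2
          + 2 * (max 0 (R s ts) * (of_bool (\<pi> s t) - a)) + (1 + \<bar>a\<bar>)\<^sup>2"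
        unfolding R using sq[of "R s ts" "of_bool (\<pi> s t) - a"] by linarith
    qed
    also have "\<dots> = (\<Sum>s\<in>B. (max 0 (R s ts))\<^sup>2)
        + 2 * (\<Sum>s\<in>B. max 0 (R s ts) * (of_bool (\<pi> s t) - a)) + c"
      by (simp add: sum.distrib sum_distrib_left c_def)
    also have "\<dots> \<le> Suc n * c"
      using ts(3) t(2) by (simp add: algebra_simps)
    finally show ?case using ts t by (intro exI[of _ "t # ts"]) auto
  qed
  \<comment> \<open>So many rounds that the square root of \<open>Suc n0 * c\<close> is at most
    \<open>Suc n0 * \<delta>\<close>; the successor keeps the list nonempty.\<close>
  moreover obtain n0 :: nat where n0: "c / \<delta>\<^sup>2 < n0" using reals_Archimedean2 by blast
  ultimately obtain ts where ts: "length ts = Suc n0" "set ts \<subseteq> T"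
    "(\<Sum>s\<in>B. (max 0 (R s ts))\<^sup>2) \<le> Suc n0 * c"
    by blast
  have "freq (\<pi> s) ts \<le> a + \<delta>" if "s \<in> B" for s
  proof -
    have "c \<le> Suc n0 * \<delta>\<^sup>2" using n0 \<open>0 < \<delta>\<close> by (simp add: field_simps add_increasing)
    have "(max 0 (R s ts))\<^sup>2 \<le> (\<Sum>s\<in>B. (max 0 (R s ts))\<^sup>2)"
      using that \<open>finite B\<close> by (intro member_le_sum) auto
    also have "\<dots> \<le> Suc n0 * (Suc n0 * \<delta>\<^sup>2)"
      using ts(3) mult_left_mono[OF \<open>c \<le> Suc n0 * \<delta>\<^sup>2\<close>, of "Suc n0"] by linarith
    also have "\<dots> = (Suc n0 * \<delta>)\<^sup>2" by (simp add: power2_eq_square)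
    finally have "max 0 (R s ts) \<le> Suc n0 * \<delta>"
      by (rule power2_le_imp_le) (use \<open>0 < \<delta>\<close> in simp)
    then have "R s ts \<le> Suc n0 * \<delta>" by simp
    then have "real (length (filter (\<pi> s) ts)) \<le> (a + \<delta>) * Suc n0"
      unfolding R_def ts(1) by (simp add: algebra_simps)
    then show ?thesis by (simp add: freq_def ts(1) divide_le_eq)
  qed
  moreover have "ts \<noteq> []" using ts(1) by auto
  ultimately show ?thesis using ts(2) by blast
qed

text \<open>Koenig's lemma: the branch \<open>f\<close> follows prefixes shared by infinitely many
  \<open>h i\<close>. Entries \<open>h i j\<close> with \<open>j > i\<close> are unconstrained, so
  only late indices count.\<close>

lemma finite_branching_cluster_point:
  fixes h :: "nat \<Rightarrow> nat \<Rightarrow> 'c"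
  assumes "\<And>j. finite (F j)" and "\<And>i j. j \<le> i \<Longrightarrow> h i j \<in> F j"
  shows "\<exists>f. \<forall>N. \<exists>i\<ge>N. \<forall>j<N. h i j = f j"
proof -
  define I where "I xs = {i. \<forall>j<length xs. h i j = xs ! j}" for xs
  have step: "\<exists>x. infinite (I (xs @ [x]))" if inf: "infinite (I xs)" for xs
  proof -
    \<comment> \<open>For smaller indices the next entry need not lie in the finite set; discarding
      them keeps the set infinite.\<close>
    let ?J = "I xs - {..<length xs}"
    have "infinite ?J" using inf by simp
    moreover have "(\<lambda>i. h i (length xs)) ` ?J \<subseteq> F (length xs)"
      using assms(2)[of "length xs"] by (auto intro: leI)
    then have "finite ((\<lambda>i. h i (length xs)) ` ?J)" using assms(1) by (rule finite_subset)
    ultimately obtain i where i: "infinite {i' \<in> ?J. h i' (length xs) = h i (length xs)}"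
      using pigeonhole_infinite[of ?J "\<lambda>i. h i (length xs)"] by blast
    have "{i' \<in> ?J. h i' (length xs) = h i (length xs)} \<subseteq> I (xs @ [h i (length xs)])"
      by (auto simp: I_def nth_append less_Suc_eq)
    then have "infinite (I (xs @ [h i (length xs)]))" using i by (rule infinite_super)
    then show ?thesis by blast
  qed
  have "\<exists>X. \<forall>n. (length (X n) = n \<and> infinite (I (X n))) \<and> (\<exists>x. X (Suc n) = X n @ [x])"
  proof (rule dependent_nat_choice)
    show "\<exists>xs. length xs = 0 \<and> infinite (I xs)" by (simp add: I_def)
    show "\<exists>ys. (length ys = Suc n \<and> infinite (I ys)) \<and> (\<exists>x. ys = xs @ [x])"
      if xs: "length xs = n \<and> infinite (I xs)" for xs n
    proof -
      obtain x where "infinite (I (xs @ [x]))" using step[of xs] xs by blast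
      then show ?thesis using xs by (intro exI[of _ "xs @ [x]"]) simp
    qed
  qed
  then obtain X where "\<forall>n. (length (X n) = n \<and> infinite (I (X n))) \<and> (\<exists>x. X (Suc n) = X n @ [x])"
    by (rule exE)
  then have X: "length (X n) = n" "infinite (I (X n))" "\<exists>x. X (Suc n) = X n @ [x]" for n
    by simp_all
  \<comment> \<open>The prefixes extend one another, so the entry at \<open>j\<close> is fixed once
    it appears and defines the branch.\<close>
  have pre: "X N ! j = X (Suc j) ! j" if "j < N" for N j
    using that
  proof (induction N)
    case (Suc N)
    obtain x where "X (Suc N) = X N @ [x]" using X(3) by blast
    then have *: "X (Suc N) ! j = X N ! j" if "j < N"
      using that X(1)[of N] by (simp add: nth_append)
    show ?case
    proof (cases "j = N")
      case False
      then have "j < N" using Suc.prems by simp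
      then have "X (Suc N) ! j = X N ! j" by (rule *)
      also have "\<dots> = X (Suc j) ! j" using \<open>j < N\<close> by (rule Suc.IH)
      finally show ?thesis .
    qed simp
  qed simp
  have "\<exists>i\<ge>N. \<forall>j<N. h i j = X (Suc j) ! j" for N
  proof -
    obtain i where "N \<le> i" and i: "i \<in> I (X N)"
      using X(2)[of N, unfolded infinite_nat_iff_unbounded_le, rule_format, of N] by (elim exE conjE)
    have "h i j = X (Suc j) ! j" if "j < N" for j
    proof -
      have "h i j = X N ! j" using i that unfolding I_def X(1) by (elim CollectE allE impE)
      also have "\<dots> = X (Suc j) ! j" using that by (rule pre)
      finally show ?thesis .
    qed
    then show ?thesis using \<open>N \<le> i\<close> by (intro exI[of _ i]) simp
  qed
  then show ?thesis by (intro exI[of _ "\<lambda>j. X (Suc j) ! j"]) simp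
qed

subsection \<open>Games of value zero\<close>

text \<open>Koenig's lemma reduces each \<open>F j\<close> to one column \<open>t j\<close>, with
  arbitrarily late rows winning against any initial segment of these columns. Thinning out then
  leaves the larger number game.\<close>

lemma not_LNG_freeI:
  fixes \<pi> :: "'a \<Rightarrow> 'b \<Rightarrow> bool" and s :: "nat \<Rightarrow> 'a" and F :: "nat \<Rightarrow> 'b set"
  assumes fin: "\<And>j. finite (F j)" and sub: "\<And>j. F j \<subseteq> T" and s: "\<And>i. s i \<in> S"
    and hit: "\<And>i j. j \<le> i \<Longrightarrow> \<exists>t\<in>F j. \<pi> (s i) t"
    and miss: "\<And>i j t. i < j \<Longrightarrow> t \<in> F j \<Longrightarrow> \<not> \<pi> (s i) t"
  shows "\<not> LNG_free S T \<pi>"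
proof -
  have "\<forall>i j. \<exists>t. j \<le> i \<longrightarrow> t \<in> F j \<and> \<pi> (s i) t" using hit by blast
  then obtain h where h: "\<And>i j. j \<le> i \<Longrightarrow> h i j \<in> F j \<and> \<pi> (s i) (h i j)"
    by metis
  obtain t where t: "\<And>N. \<exists>i\<ge>N. \<forall>j<N. h i j = t j"
    using finite_branching_cluster_point[of F h, OF fin] h by blast
  have tF: "t j \<in> F j" for j
    using t[of "Suc j"] h[of j] by (metis Suc_leD lessI)
  have "\<exists>i\<ge>n. \<forall>j\<le>n. \<pi> (s i) (t j)" for n
    using t[of "Suc n"] h by (metis Suc_leD le_imp_less_Suc le_trans)
  then obtain i where i: "\<And>n. n \<le> i n" "\<And>n j. j \<le> n \<Longrightarrow> \<pi> (s (i n)) (t j)"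
    by metis
  \<comment> \<open>The next index lies beyond the row index \<open>i (n k)\<close> just used, so by
    \<open>miss\<close> that row loses against all later columns.\<close>
  define n where "n k = ((\<lambda>m. Suc (i m)) ^^ k) 0" for k
  have n_Suc: "n (Suc k) = Suc (i (n k))" for k
    by (simp add: n_def)
  then have "n k < n (Suc k)" for k
    using i(1)[of "n k"] by (simp add: less_Suc_eq_le)
  then have mono: "strict_mono n" by (simp add: strict_mono_Suc_iff)
  let ?s = "\<lambda>k. s (i (n k))" and ?t = "\<lambda>k. t (n k)"
  have pat: "\<pi> (?s k) (?t l) \<longleftrightarrow> l \<le> k" for k l
  proof (cases "l \<le> k")
    case True
    then show ?thesis using i(2) mono by (simp add: strict_mono_less_eq)
  next
    case False
    then have "n (Suc k) \<le> n l" using mono by (simp add: strict_mono_less_eq)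
    then have "i (n k) < n l" by (simp add: n_Suc)
    then show ?thesis using False miss tF by blast
  qed
  have "inj ?s"
  proof (rule injI)
    fix k l assume "?s k = ?s l"
    then have "l \<le> k \<longleftrightarrow> l \<le> l" "k \<le> k \<longleftrightarrow> k \<le> l"
      unfolding pat[symmetric] by simp_all
    then show "k = l" by (meson order.refl order.antisym)
  qed
  moreover have "inj ?t"
  proof (rule injI)
    fix k l assume "?t k = ?t l"
    then have "k \<le> k \<longleftrightarrow> l \<le> k" "k \<le> l \<longleftrightarrow> l \<le> l"
      unfolding pat[symmetric] by simp_all
    then show "k = l" by (meson order.refl order.antisym)
  qed
  moreover have "range ?s \<subseteq> S" using s by blast
  moreover have "range ?t \<subseteq> T" using tF sub by blast
  ultimately have "inj ?s \<and> inj ?t \<and> range ?s \<subseteq> S \<and> range ?t \<subseteq> T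
      \<and> (\<forall>k l. \<pi> (?s k) (?t l) \<longleftrightarrow> l \<le> k)"
    using pat by simp
  then have "\<exists>s t. inj s \<and> inj t \<and> range s \<subseteq> S \<and> range t \<subseteq> T
      \<and> (\<forall>k l :: nat. \<pi> (s k) (t l) \<longleftrightarrow> l \<le> k)"
    by (rule exI[of _ ?s, OF exI[of _ ?t]])
  then show ?thesis unfolding LNG_free_def by simp
qed

text \<open>By \<open>avoid\<close>, single columns beat finite sets of rows; LNG-freeness extends
  this to all of \<open>S0\<close> at the price of mixing and of \<open>\<epsilon>\<close>.\<close>

lemma LNG_free_zero_value:
  fixes \<pi> :: "'a \<Rightarrow> 'b \<Rightarrow> bool"
  assumes free: "LNG_free S T \<pi>" and S0: "S0 \<subseteq> S"
    and avoid: "\<And>B. finite B \<Longrightarrow> B \<subseteq> S0 \<Longrightarrow> \<exists>t\<in>T. \<forall>s\<in>B. \<not> \<pi> s t"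
    and "0 < \<epsilon>"
  obtains ts where "ts \<noteq> []" "set ts \<subseteq> T" "\<And>s. s \<in> S0 \<Longrightarrow> freq (\<pi> s) ts \<le> \<epsilon>"
proof -
  define TB where "TB B = {t \<in> T. \<forall>s\<in>B. \<not> \<pi> s t}" for B
  \<comment> \<open>\<open>B\<close> stands for rows already picked: that later columns beat them is
    the losing half of the larger number game.\<close>
  define null where "null A \<longleftrightarrow> (\<forall>B \<epsilon>. finite B \<longrightarrow> B \<subseteq> S0 \<longrightarrow> (0::real) < \<epsilon> \<longrightarrow>
    (\<exists>ts. ts \<noteq> [] \<and> set ts \<subseteq> TB B \<and> (\<forall>s\<in>A. freq (\<pi> s) ts \<le> \<epsilon>)))" for A
  define hits where "hits F = {s. \<exists>t\<in>F. \<pi> s t}" for F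
  \<comment> \<open>Otherwise lists can be picked in turn, each at most \<open>\<delta>\<close> on
    the rows of \<open>A\<close> hit by earlier lists. A row of \<open>A\<close> then exceeds
    \<open>\<delta>\<close> on at most one list, and the average of many lists contradicts
    \<open>bad\<close>.\<close>
  have step: "\<exists>F. finite F \<and> F \<subseteq> TB B \<and> \<not> null (A \<inter> hits F)"
    if A: "\<not> null A" and B: "finite B" "B \<subseteq> S0" for A B
  proof (rule ccontr)
    assume "\<not> ?thesis"
    then have null: "null (A \<inter> hits F)" if "finite F" "F \<subseteq> TB B" for F
      using that by blast
    obtain B' \<epsilon> where B': "finite B'" "B' \<subseteq> S0" and "0 < \<epsilon>"
      and bad: "\<And>ts. ts \<noteq> [] \<Longrightarrow> set ts \<subseteq> TB B' \<Longrightarrow> \<exists>s\<in>A. \<epsilon> < freq (\<pi> s) ts"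
      using A unfolding null_def by (meson not_le)
    \<comment> \<open>One third each for the later lists, for the one exceptional list, and for the
      error of \<open>freq_mixture\<close>.\<close>
    define \<delta> where "\<delta> = \<epsilon> / 3"
    have "0 < \<delta>" using \<open>0 < \<epsilon>\<close> by (simp add: \<delta>_def)
    \<comment> \<open>Beating \<open>B\<close> makes finite subsets of \<open>X\<close> admissible
      in the assumption \<open>null\<close>; beating \<open>B'\<close> makes lists over
      \<open>X\<close> subject to \<open>bad\<close>.\<close>
    define X where "X = TB (B \<union> B')"
    have X: "X \<subseteq> TB B" "X \<subseteq> TB B'" by (auto simp: X_def TB_def)
    have ex: "\<exists>ts. ts \<noteq> [] \<and> set ts \<subseteq> X \<and> (\<forall>s\<in>A \<inter> hits F. freq (\<pi> s) ts \<le> \<delta>)"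
      if "finite F" "F \<subseteq> X" for F
    proof -
      have "null (A \<inter> hits F)" using null that X(1) by blast
      from this[unfolded null_def, rule_format, of "B \<union> B'" \<delta>] show ?thesis
        using B B' \<open>0 < \<delta>\<close> by (auto simp: X_def)
    qed
    define good where "good = (\<lambda>(F, ts). finite F \<and> F \<subseteq> X \<and> ts \<noteq> [] \<and> set ts \<subseteq> X
      \<and> (\<forall>s\<in>A \<inter> hits F. freq (\<pi> s) ts \<le> \<delta>))"
    have "\<exists>Q. \<forall>n. good (Q n) \<and> fst (Q (Suc n)) = fst (Q n) \<union> set (snd (Q n))"
    proof (rule dependent_nat_choice)
      show "\<exists>Q. good Q"
        using ex[of "{}"] by (auto simp: good_def)
    next
      fix Q :: "'b set \<times> 'b list" and n :: nat
      assume "good Q"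
      obtain F ts where Q: "Q = (F, ts)" by (cases Q)
      have "finite (F \<union> set ts)" "F \<union> set ts \<subseteq> X"
        using \<open>good Q\<close> by (auto simp: Q good_def)
      with ex[OF this] obtain ts' where "good (F \<union> set ts, ts')"
        unfolding good_def by blast
      then show "\<exists>Q'. good Q' \<and> fst Q' = fst Q \<union> set (snd Q)"
        by (intro exI[of _ "(F \<union> set ts, ts')"]) (simp add: Q)
    qed
    then obtain Q where good: "\<And>n. good (Q n)"
      and Q4: "\<And>n. fst (Q (Suc n)) = fst (Q n) \<union> set (snd (Q n))"
      by blast
    have Q: "snd (Q n) \<noteq> []" "set (snd (Q n)) \<subseteq> X"
      "s \<in> A \<Longrightarrow> s \<in> hits (fst (Q n)) \<Longrightarrow> freq (\<pi> s) (snd (Q n)) \<le> \<delta>" for n s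
      using good[of n] by (auto simp: good_def case_prod_beta)
    \<comment> \<open>The first list that meets \<open>s\<close> contributes at most 1, all later ones at most \<open>\<delta>\<close>.\<close>
    have bound: "(\<Sum>n<N. freq (\<pi> s) (snd (Q n))) \<le> of_bool (s \<in> hits (fst (Q N))) + N * \<delta>"
      if "s \<in> A" for s N
    proof (induction N)
      case (Suc N)
      consider "s \<in> hits (fst (Q N))" | "s \<notin> hits (fst (Q N))" "s \<in> hits (set (snd (Q N)))"
        | "s \<notin> hits (fst (Q N))" "s \<notin> hits (set (snd (Q N)))"
        by blast
      then show ?case
      proof cases
        case 1
        then show ?thesis using Suc Q(3)[OF that 1]
          by (auto simp: Q4 hits_def algebra_simps)
      next
        case 2
        then have "s \<in> hits (fst (Q (Suc N)))" by (auto simp: Q4 hits_def)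
        then show ?thesis using 2 Suc freq_le_1[of "\<pi> s" "snd (Q N)"] \<open>0 < \<delta>\<close>
          by (simp add: algebra_simps)
      next
        case 3
        then have "freq (\<pi> s) (snd (Q N)) = 0" by (auto simp: freq_def hits_def filter_empty_conv)
        then show ?thesis using 3 Suc \<open>0 < \<delta>\<close> by (simp add: algebra_simps)
      qed
    qed simp
    obtain N0 :: nat where "1 / \<delta> < N0" using reals_Archimedean2 by blast
    moreover define N where "N = Suc N0"
    ultimately have N: "0 < N" "1 \<le> N * \<delta>" using \<open>0 < \<delta>\<close> by (auto simp: field_simps)
    obtain ts where ts: "ts \<noteq> []" "set ts \<subseteq> X"
      "\<And>P. freq P ts \<le> (\<Sum>i<N. 1 / N * freq P (snd (Q i))) + \<delta>"
      by (rule freq_mixture[of N "\<lambda>_. 1 / N" "\<lambda>i. snd (Q i)" X \<delta>])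
        (use Q N \<open>0 < \<delta>\<close> in auto)
    have "freq (\<pi> s) ts \<le> \<epsilon>" if "s \<in> A" for s
    proof -
      have "(\<Sum>i<N. freq (\<pi> s) (snd (Q i))) \<le> 1 + N * \<delta>"
        by (rule order_trans[OF bound[OF that]]) simp
      also have "\<dots> \<le> N * (2 * \<delta>)" using N(2) by (simp add: algebra_simps)
      finally have "(\<Sum>i<N. 1 / N * freq (\<pi> s) (snd (Q i))) \<le> 2 * \<delta>"
        using N(1) by (simp add: divide_le_eq mult.commute flip: sum_divide_distrib)
      then show ?thesis using ts(3)[of "\<pi> s"] by (simp add: \<delta>_def)
    qed
    then show False using bad[OF ts(1)] ts(2) X(2) by fastforce
  qed
  have "null S0"
  proof (rule ccontr)
    assume non: "\<not> null S0"
    \<comment> \<open>The empty set is null because of \<open>avoid\<close>, so a non-null set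
      always offers a row to pick.\<close>
    have nonempty: "A \<noteq> {}" if "\<not> null A" for A
    proof
      assume "A = {}"
      have "\<exists>ts. ts \<noteq> [] \<and> set ts \<subseteq> TB B" if B: "finite B" "B \<subseteq> S0" for B
      proof -
        obtain t where "t \<in> TB B" using avoid[OF B] by (auto simp: TB_def)
        then show ?thesis by (intro exI[of _ "[t]"]) simp
      qed
      then show False using that \<open>A = {}\<close> by (simp add: null_def)
    qed
    \<comment> \<open>One stage: remaining rows \<open>A\<close>, rows \<open>B\<close> picked
      before, finitely many columns \<open>F\<close> beating \<open>B\<close>, and the next row
      \<open>s\<close>, taken from those that survive the cut by \<open>F\<close>.\<close>
    define ok where "ok = (\<lambda>(A, B, F, s). A \<subseteq> S0 \<and> finite B \<and> B \<subseteq> S0 \<and> finite F \<and> F \<subseteq> TB B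
      \<and> \<not> null (A \<inter> hits F) \<and> s \<in> A \<inter> hits F)"
    have ok_ex: "\<exists>F s. ok (A, B, F, s)"
      if AB: "A \<subseteq> S0" "finite B" "B \<subseteq> S0" "\<not> null A" for A B
    proof -
      obtain F where F: "finite F" "F \<subseteq> TB B" "\<not> null (A \<inter> hits F)"
        using step[OF AB(4,2,3)] by blast
      moreover obtain s where "s \<in> A \<inter> hits F" using nonempty[OF F(3)] by blast
      ultimately show ?thesis unfolding ok_def using AB(1-3) by auto
    qed
    define nxt where "nxt = (\<lambda>(A, B, F, s :: 'a) (A', B', F' :: 'b set, s' :: 'a).
      A' = A \<inter> hits F \<and> B' = insert s B)"
    have "\<exists>W. \<forall>n. ok (W n) \<and> nxt (W n) (W (Suc n))"
    proof (rule dependent_nat_choice)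
      show "\<exists>w. ok w" using ok_ex[of S0 "{}"] non by auto
      fix w n
      assume "ok w"
      obtain A B F s where w: "w = (A, B, F, s)" by (cases w)
      have "\<exists>F' s'. ok (A \<inter> hits F, insert s B, F', s')"
        using \<open>ok w\<close> unfolding w by (intro ok_ex) (auto simp: ok_def)
      then show "\<exists>w'. ok w' \<and> nxt w w'"
        unfolding w nxt_def by auto
    qed
    then obtain W where W: "\<And>n. ok (W n)" "\<And>n. nxt (W n) (W (Suc n))" by blast
    define A B F s where "A n = fst (W n)" and "B n = fst (snd (W n))"
      and "F n = fst (snd (snd (W n)))" and "s n = snd (snd (snd (W n)))" for n
    have Weq: "W n = (A n, B n, F n, s n)" for n
      by (simp add: A_def B_def F_def s_def)
    have *: "A n \<subseteq> S0" "finite (F n)" "F n \<subseteq> TB (B n)" "s n \<in> A n" "s n \<in> hits (F n)"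
      "A (Suc n) = A n \<inter> hits (F n)" "B (Suc n) = insert (s n) (B n)" for n
      using W(1)[of n] W(2)[of n] by (auto simp: Weq ok_def nxt_def)
    have A_mono: "A i \<subseteq> A j" if "j \<le> i" for i j
      using that by (induction i) (auto simp: *(6) le_Suc_eq)
    \<comment> \<open>A row picked later has survived the cut by \<open>F j\<close>, which is the
      winning half of the pattern; \<open>inB\<close> supplies the losing half.\<close>
    have "s i \<in> hits (F j)" if "j \<le> i" for i j
    proof (cases "j = i")
      case False
      then have "s i \<in> A (Suc j)" using A_mono[of "Suc j" i] that *(4)[of i] by auto
      then show ?thesis using *(6) by blast
    qed (use *(5) in blast)
    moreover have inB: "s i \<in> B j" if "i < j" for i j
      using that by (induction j) (auto simp: *(7) less_Suc_eq)
    moreover have "F j \<subseteq> T" for j using *(3)[of j] by (auto simp: TB_def)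
    moreover have "s i \<in> S" for i using * S0 by blast
    moreover have "\<not> \<pi> (s i) t" if "i < j" "t \<in> F j" for i j t
      using inB[OF that(1)] that(2) *(3)[of j] by (auto simp: TB_def)
    ultimately have "\<not> LNG_free S T \<pi>"
      using *(2) by (intro not_LNG_freeI[where F = F and s = s]) (auto simp: hits_def)
    then show False using free by blast
  qed
  then obtain ts where "ts \<noteq> []" "set ts \<subseteq> TB {}" "\<forall>s\<in>S0. freq (\<pi> s) ts \<le> \<epsilon>"
    unfolding null_def using \<open>0 < \<epsilon>\<close> by blast
  then show thesis using that[of ts] by (auto simp: TB_def)
qed

subsection \<open>The general upper value\<close>

lemma LNG_free_subset:
  assumes "LNG_free S T \<pi>" "S' \<subseteq> S" "T' \<subseteq> T"
  shows "LNG_free S' T' \<pi>"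
  using assms unfolding LNG_free_def by (meson order_trans)

text \<open>By Tychonoff the functions from sets of columns to the unit interval form a compact
  space, in which additivity, total mass 1 and each row bound are closed conditions. Frequencies
  along the lists from \<open>L\<close> satisfy any finite number of row bounds.\<close>

lemma finitely_additive_limit:
  fixes \<pi> :: "'a \<Rightarrow> 'b \<Rightarrow> bool"
  assumes L: "\<And>B. finite B \<Longrightarrow> B \<subseteq> S \<Longrightarrow>
      \<exists>ts. ts \<noteq> [] \<and> set ts \<subseteq> T \<and> (\<forall>s\<in>B. freq (\<pi> s) ts \<le> a)"
  shows "\<exists>l :: 'b set \<Rightarrow> real. (\<forall>X. 0 \<le> l X) \<and> (\<forall>X Y. X \<inter> Y = {} \<longrightarrow> l (X \<union> Y) = l X + l Y)
    \<and> l T = 1 \<and> (\<forall>s\<in>S. l {t. \<pi> s t} \<le> a)"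
proof -
  define P :: "('b set \<Rightarrow> real) set" where "P = PiE UNIV (\<lambda>_. {0..1})"
  define C :: "('b set \<Rightarrow> real) set"
    where "C = {l. (\<forall>X Y. X \<inter> Y = {} \<longrightarrow> l (X \<union> Y) = l X + l Y) \<and> l T = 1}"
  have "compactin (product_topology (\<lambda>_ :: 'b set. euclidean) UNIV) P"
    unfolding P_def compactin_PiE by simp
  then have "compact P"
    by (simp add: euclidean_product_topology)
  moreover have "closed C"
  proof -
    have "closed {l :: 'b set \<Rightarrow> real. X \<inter> Y = {} \<longrightarrow> l (X \<union> Y) = l X + l Y}" for X Y
    proof (cases "X \<inter> Y = {}")
      case True
      have "closed {l :: 'b set \<Rightarrow> real. l (X \<union> Y) = l X + l Y}"
        by (intro closed_Collect_eq continuous_on_add continuous_on_product_coordinates)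
      then show ?thesis using True by simp
    qed simp
    moreover have "closed {l :: 'b set \<Rightarrow> real. l T = 1}"
      by (intro closed_Collect_eq continuous_on_const continuous_on_product_coordinates)
    ultimately show ?thesis
      unfolding C_def by (intro closed_Collect_conj closed_Collect_all)
  qed
  ultimately have "compact (P \<inter> C)" by (rule compact_Int_closed)
  moreover define H where "H s = {l :: 'b set \<Rightarrow> real. l {t. \<pi> s t} \<le> a}" for s
  have "closed (H s)" for s
    unfolding H_def
    by (intro closed_Collect_le continuous_on_const continuous_on_product_coordinates)
  moreover have "(P \<inter> C) \<inter> (\<Inter>s\<in>B. H s) \<noteq> {}" if B: "finite B" "B \<subseteq> S" for B
  proof -
    obtain ts where ts: "ts \<noteq> []" "set ts \<subseteq> T" "\<forall>s\<in>B. freq (\<pi> s) ts \<le> a"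
      using L[OF B] by blast
    define l where "l X = freq (\<lambda>t. t \<in> X) ts" for X
    have "length (filter (\<lambda>t. t \<in> X \<union> Y) us)
        = length (filter (\<lambda>t. t \<in> X) us) + length (filter (\<lambda>t. t \<in> Y) us)"
      if "X \<inter> Y = {}" for X Y and us :: "'b list"
      using that by (induction us) auto
    then have "l (X \<union> Y) = l X + l Y" if "X \<inter> Y = {}" for X Y
      using that by (simp add: l_def freq_def add_divide_distrib)
    moreover have "filter (\<lambda>t. t \<in> T) ts = ts" using ts(2) by (simp add: subset_iff)
    then have "l T = 1" using ts(1) by (simp add: l_def freq_def)
    moreover have "l \<in> P" by (auto simp: P_def l_def freq_nonneg freq_le_1)
    moreover have "l \<in> (\<Inter>s\<in>B. H s)" using ts(3) by (simp add: H_def l_def)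
    ultimately have "l \<in> (P \<inter> C) \<inter> (\<Inter>s\<in>B. H s)" by (simp add: C_def)
    then show ?thesis by blast
  qed
  ultimately have "(P \<inter> C) \<inter> (\<Inter>s\<in>S. H s) \<noteq> {}"
    by (rule compact_imp_fip_image)
  then obtain l where "l \<in> P" "l \<in> C" "\<forall>s\<in>S. l \<in> H s" by blast
  then show ?thesis
    by (intro exI[of _ l]) (auto simp: P_def C_def H_def PiE_def Pi_def)
qed

text \<open>Countability of \<open>T\<close> lets one sequence \<open>Q\<close> list all mixed
  columns, so that any list found later is some \<open>Q k\<close>.\<close>

lemma countable_columns_upper_value:
  fixes \<pi> :: "'a \<Rightarrow> 'b \<Rightarrow> bool"
  assumes free: "LNG_free S T \<pi>" and "countable T" and "a < b"
    and L: "\<And>B. finite B \<Longrightarrow> B \<subseteq> S \<Longrightarrow>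
      \<exists>ts. ts \<noteq> [] \<and> set ts \<subseteq> T \<and> (\<forall>s\<in>B. freq (\<pi> s) ts \<le> a)"
  shows "\<exists>ts. ts \<noteq> [] \<and> set ts \<subseteq> T \<and> (\<forall>s\<in>S. freq (\<pi> s) ts \<le> b)"
proof -
  from finitely_additive_limit[of S T \<pi> a, OF L] obtain l :: "'b set \<Rightarrow> real"
    where l_nonneg: "\<And>X. 0 \<le> l X"
      and l_add: "\<And>X Y. X \<inter> Y = {} \<Longrightarrow> l (X \<union> Y) = l X + l Y"
      and l_T: "l T = 1" and l_row: "\<And>s. s \<in> S \<Longrightarrow> l {t. \<pi> s t} \<le> a"
    by metis
  have l_split: "l X = l (X \<inter> Y) + l (X - Y)" for X Y
    using l_add[of "X \<inter> Y" "X - Y"] by (simp add: Int_Diff_Un Int_Diff Diff_Int_distrib)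
  have l_mono: "l X \<le> l Y" if "X \<subseteq> Y" for X Y
    using l_split[of Y X] that l_nonneg[of "Y - X"] by (simp add: Int_absorb1)
  \<comment> \<open>One third each for rows on which \<open>Q k\<close> is small, for the summed
    errors \<open>\<epsilon> / 2 ^ Suc k\<close>, and for \<open>freq_mixture\<close>.\<close>
  define \<epsilon> where "\<epsilon> = (b - a) / 3"
  have "0 < \<epsilon>" using \<open>a < b\<close> by (simp add: \<epsilon>_def)
  have "{ts. ts \<noteq> [] \<and> set ts \<subseteq> T} \<subseteq> lists T" by (auto simp: lists_eq_set)
  then have "countable {ts. ts \<noteq> [] \<and> set ts \<subseteq> T}"
    using \<open>countable T\<close> countable_lists countable_subset by blast
  moreover have "{ts. ts \<noteq> [] \<and> set ts \<subseteq> T} \<noteq> {}" using L[of "{}"] by auto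
  ultimately obtain Q :: "nat \<Rightarrow> 'b list" where Q: "range Q = {ts. ts \<noteq> [] \<and> set ts \<subseteq> T}"
    using range_from_nat_into by metis
  have Q_ne: "Q k \<noteq> []" and Q_sub: "set (Q k) \<subseteq> T" for k
    using Q by blast+
  define R where "R k = {s \<in> S. \<epsilon> < freq (\<pi> s) (Q k)}" for k
  define C where "C B = {t \<in> T. \<forall>s\<in>B. \<pi> s t}" for B
  \<comment> \<open>\<open>B\<close> nearly minimises \<open>l (C B)\<close>, so one more row of
    \<open>R k\<close> barely shrinks \<open>C B\<close>: each such row wins on all of
    \<open>C B\<close> up to a set of small \<open>l\<close>.\<close>
  have "\<exists>B. finite B \<and> B \<subseteq> R k \<and> (\<forall>s\<in>R k. l (C B) \<le> l (C (insert s B)) + \<epsilon> / 2 ^ Suc k)" for k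
  proof -
    let ?\<B> = "{B. finite B \<and> B \<subseteq> R k}" and ?f = "\<lambda>B. l (C B)"
    have bdd: "bdd_below (?f ` ?\<B>)" by (intro bdd_belowI2[of _ 0]) (rule l_nonneg)
    have "(INF B\<in>?\<B>. ?f B) < (INF B\<in>?\<B>. ?f B) + \<epsilon> / 2 ^ Suc k" using \<open>0 < \<epsilon>\<close> by simp
    moreover have "?\<B> \<noteq> {}" by blast
    ultimately obtain B where B: "B \<in> ?\<B>" "?f B < (INF B\<in>?\<B>. ?f B) + \<epsilon> / 2 ^ Suc k"
      using cINF_less_iff[of ?\<B> ?f] bdd by blast
    have "(INF B\<in>?\<B>. ?f B) \<le> ?f (insert s B)" if "s \<in> R k" for s
      using B(1) that by (intro cINF_lower bdd) auto
    then show ?thesis using B by (intro exI[of _ B]) fastforce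
  qed
  then obtain B where B: "\<And>k. finite (B k)" "\<And>k. B k \<subseteq> R k"
    "\<And>k s. s \<in> R k \<Longrightarrow> l (C (B k)) \<le> l (C (insert s (B k))) + \<epsilon> / 2 ^ Suc k"
    by metis
  \<comment> \<open>Otherwise a cluster point of the rows missed by ever later columns is a set of rows with
    value 0 on which no \<open>Q k\<close> is small.\<close>
  have "\<exists>K. \<forall>t\<in>T. \<exists>k<K. t \<in> C (B k)"
  proof (rule ccontr)
    assume "\<not> ?thesis"
    then have "\<not> (\<forall>t\<in>T. \<exists>k<Suc i. t \<in> C (B k))" for i by blast
    then have "\<exists>t\<in>T. \<forall>k\<le>i. \<exists>s\<in>B k. \<not> \<pi> s t" for i
      by (auto simp: C_def less_Suc_eq_le)
    then obtain t where t: "\<And>i. t i \<in> T" "\<And>i k. k \<le> i \<Longrightarrow> \<exists>s\<in>B k. \<not> \<pi> s (t i)"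
      by metis
    then have "\<forall>i k. \<exists>s. k \<le> i \<longrightarrow> s \<in> B k \<and> \<not> \<pi> s (t i)" by blast
    then obtain h where h: "\<And>i k. k \<le> i \<Longrightarrow> h i k \<in> B k \<and> \<not> \<pi> (h i k) (t i)"
      by metis
    obtain f where f: "\<And>N. \<exists>i\<ge>N. \<forall>j<N. h i j = f j"
      using finite_branching_cluster_point[of B h, OF B(1)] h by blast
    have fB: "f k \<in> B k" for k
      using f[of "Suc k"] h[of k] by (metis Suc_leD lessI)
    have "range f \<subseteq> S" using fB B(2) by (auto simp: R_def)
    moreover have "\<exists>t\<in>T. \<forall>s\<in>A. \<not> \<pi> s t" if A: "finite A" "A \<subseteq> range f" for A
    proof -
      obtain J where J: "finite J" "A = f ` J" using finite_subset_image[OF A] by auto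
      then obtain N where N: "J \<subseteq> {..<N}" using finite_nat_bounded by blast
      obtain i where i: "N \<le> i" "\<forall>j<N. h i j = f j" using f by blast
      have "\<not> \<pi> (f j) (t i)" if "j < N" for j
        using h[of j i] i that by auto
      then show ?thesis using t(1)[of i] J(2) N by auto
    qed
    ultimately obtain ts where ts: "ts \<noteq> []" "set ts \<subseteq> T"
      "\<And>s. s \<in> range f \<Longrightarrow> freq (\<pi> s) ts \<le> \<epsilon>"
      using LNG_free_zero_value[OF free _ _ \<open>0 < \<epsilon>\<close>, of "range f"] by blast
    \<comment> \<open>The diagonal clash: \<open>f k\<close> is a row of \<open>R k\<close>, on
      which \<open>Q k\<close> exceeds \<open>\<epsilon>\<close>.\<close>
    then obtain k where "ts = Q k" using Q by blast
    then show False using ts(3)[of "f k"] fB[of k] B(2)[of k] by (auto simp: R_def)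
  qed
  then obtain K where K: "\<And>t. t \<in> T \<Longrightarrow> \<exists>k<K. t \<in> C (B k)" by blast
  \<comment> \<open>Each column goes to the first \<open>C (B k)\<close> containing it and is
    replaced by \<open>Q k\<close>, which therefore gets weight \<open>l (D k)\<close>.\<close>
  define D where "D k = C (B k) - (\<Union>j<k. C (B j))" for k
  have D_sum: "(\<Sum>k<n. l (D k \<inter> X)) = l ((\<Union>k<n. C (B k)) \<inter> X)" for n X
  proof (induction n)
    case 0
    show ?case using l_add[of "{}" "{}"] by simp
  next
    case (Suc n)
    have "(\<Union>k<Suc n. C (B k)) \<inter> X = ((\<Union>k<n. C (B k)) \<inter> X) \<union> (D n \<inter> X)"
      by (auto simp: D_def less_Suc_eq)
    moreover have "((\<Union>k<n. C (B k)) \<inter> X) \<inter> (D n \<inter> X) = {}" by (auto simp: D_def)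
    ultimately show ?case using Suc l_add by simp
  qed
  have "(\<Union>k<K. C (B k)) = T" using K by (auto simp: C_def)
  then have sum_1: "(\<Sum>k<K. l (D k)) = 1" using D_sum[where n = K and X = UNIV] l_T by simp
  obtain ts where ts: "ts \<noteq> []" "set ts \<subseteq> T"
    "\<And>P. freq P ts \<le> (\<Sum>k<K. l (D k) * freq P (Q k)) + \<epsilon>"
    using freq_mixture[of K "\<lambda>k. l (D k)" Q T \<epsilon>] l_nonneg sum_1 Q_ne Q_sub \<open>0 < \<epsilon>\<close> by blast
  have "freq (\<pi> s) ts \<le> b" if "s \<in> S" for s
  proof -
    let ?X = "{t. \<pi> s t}"
    \<comment> \<open>Off \<open>R k\<close> the list \<open>Q k\<close> is small. On
      \<open>R k\<close> its frequency is at most 1, while nearly all of \<open>D k\<close> lies in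
      \<open>?X\<close>.\<close>
    have summand: "l (D k) * freq (\<pi> s) (Q k) \<le> l (D k) * \<epsilon> + l (D k \<inter> ?X) + \<epsilon> / 2 ^ Suc k" for k
    proof (cases "s \<in> R k")
      case True
      have "C (B k) \<inter> ?X = C (insert s (B k))" by (auto simp: C_def)
      then have "l (C (B k) \<inter> ?X) = l (C (insert s (B k)))" by (rule arg_cong)
      then have "l (C (B k) - ?X) \<le> \<epsilon> / 2 ^ Suc k"
        using l_split[of "C (B k)" ?X] B(3)[OF True] by linarith
      moreover have "l (D k - ?X) \<le> l (C (B k) - ?X)" by (intro l_mono) (auto simp: D_def)
      ultimately have "l (D k) \<le> l (D k \<inter> ?X) + \<epsilon> / 2 ^ Suc k"
        using l_split[of "D k" ?X] by linarith
      moreover have "l (D k) * freq (\<pi> s) (Q k) \<le> l (D k)"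
        using mult_left_le[OF freq_le_1 l_nonneg] .
      moreover have "0 \<le> l (D k) * \<epsilon>" using l_nonneg \<open>0 < \<epsilon>\<close> by simp
      ultimately show ?thesis by linarith
    next
      case False
      then have "freq (\<pi> s) (Q k) \<le> \<epsilon>" using that by (simp add: R_def)
      then have "l (D k) * freq (\<pi> s) (Q k) \<le> l (D k) * \<epsilon>"
        using l_nonneg by (rule mult_left_mono)
      moreover have "0 \<le> \<epsilon> / 2 ^ Suc k" using \<open>0 < \<epsilon>\<close> by simp
      ultimately show ?thesis using l_nonneg[of "D k \<inter> ?X"] by linarith
    qed
    have "(\<Sum>k<n. \<epsilon> / 2 ^ Suc k) = \<epsilon> - \<epsilon> / 2 ^ n" for n
      by (induction n) (auto simp: field_simps)
    then have geo: "(\<Sum>k<K. \<epsilon> / 2 ^ Suc k) \<le> \<epsilon>" using \<open>0 < \<epsilon>\<close> by simp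
    have "(\<Sum>k<K. l (D k) * freq (\<pi> s) (Q k))
        \<le> (\<Sum>k<K. l (D k) * \<epsilon> + l (D k \<inter> ?X) + \<epsilon> / 2 ^ Suc k)"
      by (intro sum_mono summand)
    also have "\<dots> = \<epsilon> + (\<Sum>k<K. l (D k \<inter> ?X)) + (\<Sum>k<K. \<epsilon> / 2 ^ Suc k)"
      by (simp only: sum.distrib flip: sum_distrib_right) (simp add: sum_1)
    also have "(\<Sum>k<K. l (D k \<inter> ?X)) \<le> l ?X"
      unfolding D_sum by (intro l_mono) auto
    also have "l ?X \<le> a" using that by (rule l_row)
    finally have "(\<Sum>k<K. l (D k) * freq (\<pi> s) (Q k)) \<le> \<epsilon> + a + \<epsilon>" using geo by linarith
    then show ?thesis using ts(3)[of "\<pi> s"] by (simp add: \<epsilon>_def field_simps)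
  qed
  then show ?thesis using ts(1,2) by (intro exI[of _ ts]) simp
qed

text \<open>A closure argument as for the downward Loewenheim-Skolem theorem: \<open>f\<close> picks
  a row refuting a list, \<open>g\<close> a list good against a finite set of rows. A countable
  subgame closed under both inherits the hypothesis \<open>L\<close> but violates the
  conclusion.\<close>

lemma LNG_free_upper_value:
  fixes \<pi> :: "'a \<Rightarrow> 'b \<Rightarrow> bool"
  assumes free: "LNG_free S T \<pi>" and "a < b"
    and L: "\<And>B. finite B \<Longrightarrow> B \<subseteq> S \<Longrightarrow>
      \<exists>ts. ts \<noteq> [] \<and> set ts \<subseteq> T \<and> (\<forall>s\<in>B. freq (\<pi> s) ts \<le> a)"
  shows "\<exists>ts. ts \<noteq> [] \<and> set ts \<subseteq> T \<and> (\<forall>s\<in>S. freq (\<pi> s) ts \<le> b)"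
proof (rule ccontr)
  assume "\<not> ?thesis"
  then have "\<forall>ts. \<exists>s. ts \<noteq> [] \<and> set ts \<subseteq> T \<longrightarrow> s \<in> S \<and> b < freq (\<pi> s) ts"
    by (meson not_le)
  then obtain f where f: "\<And>ts. ts \<noteq> [] \<Longrightarrow> set ts \<subseteq> T \<Longrightarrow> f ts \<in> S \<and> b < freq (\<pi> (f ts)) ts"
    by metis
  have "\<forall>B. \<exists>ts. finite B \<and> B \<subseteq> S \<longrightarrow> ts \<noteq> [] \<and> set ts \<subseteq> T \<and> (\<forall>s\<in>B. freq (\<pi> s) ts \<le> a)"
    using L by blast
  then obtain g where g: "\<And>B. finite B \<Longrightarrow> B \<subseteq> S \<Longrightarrow>
      g B \<noteq> [] \<and> set (g B) \<subseteq> T \<and> (\<forall>s\<in>B. freq (\<pi> s) (g B) \<le> a)"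
    by metis
  define lst where "lst X = {ts. ts \<noteq> [] \<and> set ts \<subseteq> X}" for X :: "'b set"
  define fin where "fin A = {B. finite B \<and> B \<subseteq> A}" for A :: "'a set"
  define W where "W n = ((\<lambda>(A, X). (A \<union> f ` lst X, X \<union> (\<Union>B\<in>fin A. set (g B)))) ^^ n) ({}, {})" for n
  define A X where "A n = fst (W n)" and "X n = snd (W n)" for n
  have A_0: "A 0 = {}" and X_0: "X 0 = {}" by (simp_all add: A_def X_def W_def)
  have A_Suc: "A (Suc n) = A n \<union> f ` lst (X n)"
    and X_Suc: "X (Suc n) = X n \<union> (\<Union>B\<in>fin (A n). set (g B))" for n
    by (simp_all add: A_def X_def W_def case_prod_beta)
  have sub: "A n \<subseteq> S \<and> X n \<subseteq> T" for n
  proof (induction n)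
    case (Suc n)
    have "f ` lst (X n) \<subseteq> S" using f Suc by (auto simp: lst_def)
    moreover have "set (g B) \<subseteq> T" if "B \<in> fin (A n)" for B
      using g[of B] Suc that by (auto simp: fin_def)
    ultimately show ?case using Suc by (auto simp: A_Suc X_Suc)
  qed (simp add: A_0 X_0)
  have cnt: "countable (A n) \<and> countable (X n)" for n
  proof (induction n)
    case (Suc n)
    have "lst (X n) \<subseteq> lists (X n)" by (auto simp: lst_def lists_eq_set)
    then have "countable (lst (X n))" using Suc countable_lists countable_subset by blast
    moreover have "countable (fin (A n))"
      unfolding fin_def using Suc by (intro countable_Collect_finite_subset) simp
    ultimately show ?case using Suc by (auto simp: A_Suc X_Suc intro: countable_finite)
  qed (simp add: A_0 X_0)
  have A_mono: "incseq A" and X_mono: "incseq X"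
    by (intro incseq_SucI; auto simp: A_Suc X_Suc)+
  have absorb: "\<exists>n. B \<subseteq> Y n" if "finite B" "B \<subseteq> (\<Union>n. Y n)" "incseq Y"
    for B :: "'c set" and Y :: "nat \<Rightarrow> 'c set"
    using that(1,2)
  proof (induction B rule: finite_induct)
    case (insert x B)
    then obtain m n where "B \<subseteq> Y m" "x \<in> Y n" by auto
    moreover have "Y m \<subseteq> Y (max m n)" "Y n \<subseteq> Y (max m n)"
      using \<open>incseq Y\<close> by (simp_all add: incseqD)
    ultimately show ?case by blast
  qed simp
  have "\<exists>ts. ts \<noteq> [] \<and> set ts \<subseteq> (\<Union>n. X n) \<and> (\<forall>s\<in>(\<Union>n. A n). freq (\<pi> s) ts \<le> b)"
  proof (rule countable_columns_upper_value)
    show "LNG_free (\<Union>n. A n) (\<Union>n. X n) \<pi>"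
      by (rule LNG_free_subset[OF free]) (use sub in blast)+
    show "countable (\<Union>n. X n)" using cnt by blast
    show "a < b" by fact
    fix B assume B: "finite B" "B \<subseteq> (\<Union>n. A n)"
    then obtain n where n: "B \<subseteq> A n" using absorb[OF _ _ A_mono] by blast
    then have "set (g B) \<subseteq> X (Suc n)" using B(1) by (auto simp: X_Suc fin_def)
    then show "\<exists>ts. ts \<noteq> [] \<and> set ts \<subseteq> (\<Union>n. X n) \<and> (\<forall>s\<in>B. freq (\<pi> s) ts \<le> a)"
      using g[of B] B(1) n sub by (intro exI[of _ "g B"]) blast
  qed
  then obtain ts where ts: "ts \<noteq> []" "set ts \<subseteq> (\<Union>n. X n)"
    "\<And>s. s \<in> (\<Union>n. A n) \<Longrightarrow> freq (\<pi> s) ts \<le> b"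
    by blast
  \<comment> \<open>The entries of \<open>ts\<close> all lie in one stage, so the row refuting
    \<open>ts\<close> enters at the next.\<close>
  obtain n where n: "set ts \<subseteq> X n" using absorb[OF _ ts(2) X_mono] by blast
  then have "f ts \<in> A (Suc n)" using ts(1) by (auto simp: A_Suc lst_def)
  then have "freq (\<pi> (f ts)) ts \<le> b" using ts(3) by blast
  moreover have "b < freq (\<pi> (f ts)) ts" using f[OF ts(1)] n sub[of n] by auto
  ultimately show False by simp
qed

subsection \<open>Countably supported mixed strategies\<close>

text \<open>\<open>prob_of T q (\<pi> s)\<close> is the payoff of the pure row \<open>s\<close>
  against \<open>q\<close>; pure columns against mixed rows use the same constant.\<close>

definition prob_of :: "'a set \<Rightarrow> ('a \<Rightarrow> real) \<Rightarrow> ('a \<Rightarrow> bool) \<Rightarrow> real" where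
  "prob_of X p P = (\<Sum>\<^sub>\<infinity>x\<in>X. p x * of_bool (P x))"

lemma distr_nonneg: "p \<in> distr X \<Longrightarrow> 0 \<le> p x"
  by (simp add: distr_def)

lemma distr_has_sum: "p \<in> distr X \<Longrightarrow> (p has_sum 1) X"
  by (simp add: distr_def)

lemma distr_summable_times:
  assumes p: "p \<in> distr X" and g: "\<And>x. x \<in> X \<Longrightarrow> 0 \<le> g x" "\<And>x. x \<in> X \<Longrightarrow> g x \<le> c"
  shows "(\<lambda>x. p x * g x) summable_on X"
proof (rule summable_on_comparison_test)
  show "(\<lambda>x. p x * c) summable_on X"
    using has_sum_cmult_left[OF distr_has_sum[OF p]] by (rule has_sum_imp_summable)
qed (use distr_nonneg[OF p] g in \<open>auto intro: mult_left_mono\<close>)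

lemma distr_average_le:
  assumes p: "p \<in> distr X" and g: "\<And>x. x \<in> X \<Longrightarrow> 0 \<le> g x" "\<And>x. x \<in> X \<Longrightarrow> g x \<le> c"
  shows "(\<Sum>\<^sub>\<infinity>x\<in>X. p x * g x) \<le> c"
proof -
  have c: "((\<lambda>x. p x * c) has_sum c) X"
    using has_sum_cmult_left[OF distr_has_sum[OF p], of c] by simp
  show ?thesis
    by (rule has_sum_mono[OF has_sum_infsum[OF distr_summable_times[OF p g]] c])
      (use distr_nonneg[OF p] g in \<open>auto intro: mult_left_mono\<close>)
qed

text \<open>The upper bound \<open>d\<close> secures summability; a divergent \<open>infsum\<close>
  would default to 0.\<close>

lemma distr_average_ge:
  assumes p: "p \<in> distr X" and g: "\<And>x. x \<in> X \<Longrightarrow> 0 \<le> g x" "\<And>x. x \<in> X \<Longrightarrow> g x \<le> d"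
    and ge: "\<And>x. x \<in> X \<Longrightarrow> c \<le> g x"
  shows "c \<le> (\<Sum>\<^sub>\<infinity>x\<in>X. p x * g x)"
proof -
  have c: "((\<lambda>x. p x * c) has_sum c) X"
    using has_sum_cmult_left[OF distr_has_sum[OF p], of c] by simp
  show ?thesis
    by (rule has_sum_mono[OF c has_sum_infsum[OF distr_summable_times[OF p g]]])
      (use distr_nonneg[OF p] ge in \<open>auto intro: mult_left_mono\<close>)
qed

lemma prob_of_nonneg: "p \<in> distr X \<Longrightarrow> 0 \<le> prob_of X p P"
  unfolding prob_of_def by (rule distr_average_ge[where d = 1]) auto

lemma prob_of_le_1: "p \<in> distr X \<Longrightarrow> prob_of X p P \<le> 1"
  unfolding prob_of_def by (rule distr_average_le) auto

lemma prob_of_summable: "p \<in> distr X \<Longrightarrow> (\<lambda>x. p x * of_bool (P x)) summable_on X"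
  by (rule distr_summable_times[where c = 1]) auto

lemma sum_le_prob_of:
  assumes "p \<in> distr X" "finite F" "F \<subseteq> X" "\<And>x. x \<in> F \<Longrightarrow> P x"
  shows "sum p F \<le> prob_of X p P"
proof -
  have "sum p F = (\<Sum>x\<in>F. p x * of_bool (P x))" using assms(4) by simp
  also have "\<dots> \<le> prob_of X p P"
    unfolding prob_of_def using assms
    by (intro finite_sum_le_infsum prob_of_summable) (auto simp: distr_nonneg)
  finally show ?thesis .
qed

lemma prob_of_not:
  assumes "p \<in> distr X"
  shows "prob_of X p P + prob_of X p (\<lambda>x. \<not> P x) = 1"
proof -
  have "prob_of X p P + prob_of X p (\<lambda>x. \<not> P x)
      = (\<Sum>\<^sub>\<infinity>x\<in>X. p x * of_bool (P x) + p x * of_bool (\<not> P x))"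
    unfolding prob_of_def by (rule infsum_add[symmetric]; rule prob_of_summable[OF assms])
  also have "\<dots> = infsum p X" by (intro infsum_cong) auto
  also have "\<dots> = 1" using distr_has_sum[OF assms] by (rule infsumI)
  finally show ?thesis .
qed

text \<open>Domination by the product distribution \<open>p s * q t\<close>; this justifies both
  orders of summation in \<open>mix_rows\<close> and \<open>mix_columns\<close>.\<close>

lemma mix_summable:
  assumes p: "p \<in> distr S" and q: "q \<in> distr T"
  shows "(\<lambda>(s, t). p s * q t * of_bool (\<pi> s t)) summable_on S \<times> T"
proof (rule summable_on_comparison_test)
  have "((\<lambda>t. p s * q t) has_sum p s) T" for s
    using has_sum_cmult_right[OF distr_has_sum[OF q], of "p s"] by simp
  then show "(\<lambda>(s, t). p s * q t) summable_on S \<times> T"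
    using has_sum_imp_summable[OF distr_has_sum[OF p]] distr_nonneg[OF p] distr_nonneg[OF q]
    by (intro summable_on_SigmaI[where g = p]) auto
qed (use distr_nonneg[OF p] distr_nonneg[OF q] in auto)

lemma mix_rows:
  assumes "p \<in> distr S" "q \<in> distr T"
  shows "mix \<pi> S T p q = (\<Sum>\<^sub>\<infinity>s\<in>S. p s * prob_of T q (\<pi> s))"
  unfolding mix_def infsum_Sigma'_banach[OF mix_summable[OF assms], symmetric]
  by (simp add: prob_of_def mult.assoc infsum_cmult_right')

lemma mix_columns:
  assumes "p \<in> distr S" "q \<in> distr T"
  shows "mix \<pi> S T p q = (\<Sum>\<^sub>\<infinity>t\<in>T. q t * prob_of S p (\<lambda>s. \<pi> s t))"
  unfolding mix_def infsum_Sigma'_banach[OF mix_summable[OF assms], symmetric]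
    infsum_swap_banach[OF mix_summable[OF assms]] prob_of_def infsum_cmult_right'[symmetric]
  by (intro infsum_cong) simp

lemma mix_nonneg: "p \<in> distr S \<Longrightarrow> q \<in> distr T \<Longrightarrow> 0 \<le> mix \<pi> S T p q"
  by (subst mix_rows) (auto intro!: distr_average_ge[where d = 1] simp: prob_of_nonneg prob_of_le_1)

lemma mix_le_1: "p \<in> distr S \<Longrightarrow> q \<in> distr T \<Longrightarrow> mix \<pi> S T p q \<le> 1"
  by (subst mix_rows) (auto intro!: distr_average_le simp: prob_of_nonneg prob_of_le_1)

section \<open>Mixed strategies of finite support\<close>

lemma finite_support_distr:
  assumes "finite F" "F \<subseteq> X" "\<And>x. 0 \<le> p x" "\<And>x. x \<notin> F \<Longrightarrow> p x = 0" "sum p F = 1"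
  shows "p \<in> distr X"
proof -
  have "{x. p x \<noteq> 0} \<subseteq> F" using assms(4) by blast
  then have "countable {x. p x \<noteq> 0}" using assms(1) by (meson countable_finite finite_subset)
  moreover have "(p has_sum 1) X"
    using assms by (intro has_sum_finite_neutralI[of F]) auto
  ultimately show ?thesis using assms by (auto simp: distr_def)
qed

lemma finite_support_prob_of:
  assumes "finite F" "F \<subseteq> X" "\<And>x. x \<notin> F \<Longrightarrow> p x = 0"
  shows "prob_of X p P = (\<Sum>x\<in>F. p x * of_bool (P x))"
  unfolding prob_of_def
  by (rule infsumI, rule has_sum_finite_neutralI[of F]) (use assms in auto)

lemma pure_distr: "x \<in> X \<Longrightarrow> (\<lambda>y. of_bool (y = x)) \<in> distr X"
  by (rule finite_support_distr[of "{x}"]) auto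

lemma pure_average:
  fixes g :: "'a \<Rightarrow> real"
  assumes "x \<in> X"
  shows "(\<Sum>\<^sub>\<infinity>y\<in>X. of_bool (y = x) * g y) = g x"
  by (rule infsumI, rule has_sum_finite_neutralI[of "{x}"]) (use assms in auto)

lemma mix_pure_row:
  "s \<in> S \<Longrightarrow> q \<in> distr T \<Longrightarrow> mix \<pi> S T (\<lambda>x. of_bool (x = s)) q = prob_of T q (\<pi> s)"
  by (simp add: mix_rows pure_distr pure_average)

lemma mix_pure_column:
  "t \<in> T \<Longrightarrow> p \<in> distr S \<Longrightarrow> mix \<pi> S T p (\<lambda>x. of_bool (x = t)) = prob_of S p (\<lambda>s. \<pi> s t)"
  by (simp add: mix_columns pure_distr pure_average)

lemma sum_freq_eq:
  assumes "finite A" "set ts \<subseteq> A"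
  shows "(\<Sum>t\<in>A. freq (\<lambda>x. x = t) ts * of_bool (P t)) = freq P ts"
proof -
  have "(\<Sum>t\<in>A. real (length (filter (\<lambda>x. x = t) ts)) * of_bool (P t)) = length (filter P ts)"
    using assms(2)
  proof (induction ts)
    case (Cons u ts)
    have "(\<Sum>t\<in>A. real (length (filter (\<lambda>x. x = t) (u # ts))) * of_bool (P t))
        = (\<Sum>t\<in>A. (if t = u then of_bool (P u) else 0)
            + real (length (filter (\<lambda>x. x = t) ts)) * of_bool (P t))"
      by (intro sum.cong) auto
    also have "\<dots> = of_bool (P u) + length (filter P ts)"
      using Cons assms(1) by (simp add: sum.distrib)
    finally show ?case by simp
  qed simp
  then show ?thesis
    by (simp add: freq_def flip: sum_divide_distrib)
qed

lemma uniform_distr: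
  assumes "ts \<noteq> []" "set ts \<subseteq> T"
  shows "(\<lambda>t. freq (\<lambda>x. x = t) ts) \<in> distr T"
proof (rule finite_support_distr[of "set ts"])
  show "(\<Sum>t\<in>set ts. freq (\<lambda>x. x = t) ts) = 1"
    using sum_freq_eq[of "set ts" ts "\<lambda>_. True"] assms(1) by (simp add: freq_def[of "\<lambda>_. True"])
qed (use assms in \<open>auto simp: freq_nonneg freq_def filter_empty_conv\<close>)

lemma uniform_prob_of:
  assumes "set ts \<subseteq> T"
  shows "prob_of T (\<lambda>t. freq (\<lambda>x. x = t) ts) P = freq P ts"
proof -
  have "prob_of T (\<lambda>t. freq (\<lambda>x. x = t) ts) P = (\<Sum>t\<in>set ts. freq (\<lambda>x. x = t) ts * of_bool (P t))"
    using assms by (intro finite_support_prob_of) (auto simp: freq_def filter_empty_conv)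
  also have "\<dots> = freq P ts" by (rule sum_freq_eq) auto
  finally show ?thesis .
qed

section \<open>Lower and upper value\<close>

lemma bdd_below_mix: "p \<in> distr S \<Longrightarrow> bdd_below ((\<lambda>q. mix \<pi> S T p q) ` distr T)"
  by (rule bdd_belowI2[of _ 0]) (rule mix_nonneg)

lemma bdd_above_mix: "q \<in> distr T \<Longrightarrow> bdd_above ((\<lambda>p. mix \<pi> S T p q) ` distr S)"
  by (rule bdd_aboveI2[of _ _ 1]) (rule mix_le_1)

lemma distr_nonempty: "X \<noteq> {} \<Longrightarrow> distr X \<noteq> {}"
  using pure_distr by fastforce

lemma INF_mix_le:
  "p \<in> distr S \<Longrightarrow> q \<in> distr T \<Longrightarrow> (INF q\<in>distr T. mix \<pi> S T p q) \<le> mix \<pi> S T p q"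
  by (intro cINF_lower bdd_below_mix)

lemma le_SUP_mix:
  "p \<in> distr S \<Longrightarrow> q \<in> distr T \<Longrightarrow> mix \<pi> S T p q \<le> (SUP p\<in>distr S. mix \<pi> S T p q)"
  by (intro cSUP_upper bdd_above_mix)

lemma bdd_above_INF_mix:
  assumes "T \<noteq> {}"
  shows "bdd_above ((\<lambda>p. INF q\<in>distr T. mix \<pi> S T p q) ` distr S)"
proof (rule bdd_aboveI2)
  fix p assume p: "p \<in> distr S"
  obtain q where q: "q \<in> distr T" using distr_nonempty[OF assms] by blast
  show "(INF q\<in>distr T. mix \<pi> S T p q) \<le> 1"
    by (rule order_trans[OF INF_mix_le[OF p q] mix_le_1[OF p q]])
qed

lemma bdd_below_SUP_mix:
  assumes "S \<noteq> {}"
  shows "bdd_below ((\<lambda>q. SUP p\<in>distr S. mix \<pi> S T p q) ` distr T)"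
proof (rule bdd_belowI2)
  fix q assume q: "q \<in> distr T"
  obtain p where p: "p \<in> distr S" using distr_nonempty[OF assms] by blast
  show "0 \<le> (SUP p\<in>distr S. mix \<pi> S T p q)"
    by (rule order_trans[OF mix_nonneg[OF p q] le_SUP_mix[OF p q]])
qed

lemma LNG_free_imp_minimax:
  fixes \<pi> :: "'a \<Rightarrow> 'b \<Rightarrow> bool"
  assumes "S \<noteq> {}" "T \<noteq> {}" and free: "LNG_free S T \<pi>"
  shows "minimax_property S T \<pi>"
proof -
  define lo where "lo = (SUP p\<in>distr S. INF q\<in>distr T. mix \<pi> S T p q)"
  define up where "up = (INF q\<in>distr T. SUP p\<in>distr S. mix \<pi> S T p q)"
  have "lo \<le> up"
    unfolding lo_def up_def
    by (intro cSUP_least cINF_greatest distr_nonempty assms) (rule order_trans[OF INF_mix_le le_SUP_mix])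
  moreover have "\<not> lo < up"
  proof
    assume "lo < up"
    \<comment> \<open>The gap is \<open>4 * d\<close>: one \<open>d\<close> each is spent on
      approaching the infimum, on \<open>finite_rows_minimax\<close> and on passing to all rows,
      leaving one for the contradiction.\<close>
    define d where "d = (up - lo) / 4"
    have "0 < d" using \<open>lo < up\<close> by (simp add: d_def)
    have "\<exists>ts. ts \<noteq> [] \<and> set ts \<subseteq> T \<and> (\<forall>s\<in>B. freq (\<pi> s) ts \<le> (lo + d) + d)"
      if B: "finite B" "B \<subseteq> S" for B
    proof -
      \<comment> \<open>A mixed row on \<open>B\<close>, extended by 0, guarantees at most
        \<open>lo\<close>, so some mixed column \<open>q\<close> holds it below
        \<open>lo + d\<close>. As the payoff is an average over \<open>q\<close>, some pure column
        does so too.\<close>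
      have "\<exists>t\<in>T. (\<Sum>s\<in>B. p s * of_bool (\<pi> s t)) \<le> lo + d"
        if p: "\<And>s. s \<in> B \<Longrightarrow> 0 \<le> p s" "sum p B = 1" for p
      proof -
        define p' where "p' s = (if s \<in> B then p s else 0)" for s
        have p': "p' \<in> distr S"
          by (rule finite_support_distr[OF B]) (use p in \<open>auto simp: p'_def\<close>)
        have "(INF q\<in>distr T. mix \<pi> S T p' q) \<le> lo"
          unfolding lo_def by (rule cSUP_upper[OF p' bdd_above_INF_mix[OF \<open>T \<noteq> {}\<close>]])
        then have "(INF q\<in>distr T. mix \<pi> S T p' q) < lo + d" using \<open>0 < d\<close> by simp
        then obtain q where q: "q \<in> distr T" "mix \<pi> S T p' q < lo + d"
          using cINF_less_iff[OF distr_nonempty[OF \<open>T \<noteq> {}\<close>] bdd_below_mix[OF p']] by blast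
        have "\<exists>t\<in>T. prob_of S p' (\<lambda>s. \<pi> s t) < lo + d"
        proof (rule ccontr)
          assume "\<not> ?thesis"
          then have "lo + d \<le> mix \<pi> S T p' q"
            unfolding mix_columns[OF p' q(1)]
            by (intro distr_average_ge[OF q(1), where d = 1])
              (auto simp: prob_of_nonneg[OF p'] prob_of_le_1[OF p'] not_less)
          then show False using q(2) by simp
        qed
        moreover have "prob_of S p' (\<lambda>s. \<pi> s t) = (\<Sum>s\<in>B. p s * of_bool (\<pi> s t))" for t
          by (subst finite_support_prob_of[OF B]) (auto simp: p'_def)
        ultimately show ?thesis by (auto intro: less_imp_le)
      qed
      then show ?thesis
        by (rule finite_rows_minimax[OF B(1) \<open>T \<noteq> {}\<close> \<open>0 < d\<close>])
    qed
    moreover have "(lo + d) + d < lo + 3 * d" using \<open>0 < d\<close> by simp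
    ultimately have "\<exists>ts. ts \<noteq> [] \<and> set ts \<subseteq> T \<and> (\<forall>s\<in>S. freq (\<pi> s) ts \<le> lo + 3 * d)"
      by (intro LNG_free_upper_value[OF free])
    then obtain ts where ts: "ts \<noteq> []" "set ts \<subseteq> T"
      "\<And>s. s \<in> S \<Longrightarrow> freq (\<pi> s) ts \<le> lo + 3 * d"
      by blast
    define q where "q = (\<lambda>t. freq (\<lambda>x. x = t) ts)"
    have q: "q \<in> distr T" unfolding q_def using ts(1,2) by (rule uniform_distr)
    have "up \<le> (SUP p\<in>distr S. mix \<pi> S T p q)"
      unfolding up_def by (rule cINF_lower[OF bdd_below_SUP_mix[OF \<open>S \<noteq> {}\<close>] q])
    also have "\<dots> \<le> lo + 3 * d"
    proof (intro cSUP_least distr_nonempty \<open>S \<noteq> {}\<close>)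
      fix p assume p: "p \<in> distr S"
      have "prob_of T q (\<pi> s) \<le> lo + 3 * d" if "s \<in> S" for s
        using ts(3)[OF that] uniform_prob_of[OF ts(2)] by (simp add: q_def)
      then show "mix \<pi> S T p q \<le> lo + 3 * d"
        unfolding mix_rows[OF p q]
        by (intro distr_average_le[OF p]) (auto simp: prob_of_nonneg[OF q])
    qed
    also have "\<dots> < up" using \<open>0 < d\<close> by (simp add: d_def field_simps)
    finally show False by simp
  qed
  ultimately show ?thesis by (simp add: minimax_property_def lo_def up_def)
qed

section \<open>Failure of minimax in the larger number game\<close>

lemma distr_range_tail:
  fixes s :: "nat \<Rightarrow> 'a"
  assumes p: "p \<in> distr (range s)" and "0 < \<epsilon>"
  shows "\<exists>N. \<forall>P. (\<forall>i<N. P (s i)) \<longrightarrow> 1 - \<epsilon> \<le> prob_of (range s) p P"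
proof -
  \<comment> \<open>Finitely many strategies carry all but \<open>\<epsilon>\<close> of the mass;
    \<open>N\<close> bounds their indices independently of \<open>P\<close>.\<close>
  obtain F where F: "finite F" "F \<subseteq> range s" "dist (sum p F) 1 \<le> \<epsilon>"
    using has_sum_finite_approximation[OF distr_has_sum[OF p] \<open>0 < \<epsilon>\<close>] by blast
  obtain J where J: "finite J" "F = s ` J" using finite_subset_image[OF F(1,2)] by auto
  then obtain N where N: "J \<subseteq> {..<N}" using finite_nat_bounded by blast
  have "1 - \<epsilon> \<le> prob_of (range s) p P" if "\<forall>i<N. P (s i)" for P
  proof -
    have "sum p F \<le> prob_of (range s) p P"
      using that N J(2) by (intro sum_le_prob_of[OF p F(1,2)]) auto
    then show ?thesis using F(3) by (simp add: dist_real_def)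
  qed
  then show ?thesis by (intro exI[of _ N]) simp
qed

text \<open>Whoever knows the opponent's mixture picks an index beyond the bulk of its mass. So the
  lower value is at most 0 and the upper value at least 1.\<close>

lemma LNG_not_minimax:
  fixes s :: "nat \<Rightarrow> 'a" and t :: "nat \<Rightarrow> 'b"
  assumes \<pi>: "\<And>i j. \<pi> (s i) (t j) \<longleftrightarrow> j \<le> i"
  shows "\<not> minimax_property (range s) (range t) \<pi>"
proof -
  let ?S = "range s" and ?T = "range t"
  have ne: "distr ?S \<noteq> {}" "distr ?T \<noteq> {}" by (simp_all add: distr_nonempty)
  have "(SUP p\<in>distr ?S. INF q\<in>distr ?T. mix \<pi> ?S ?T p q) \<le> 0"
  proof (rule cSUP_least[OF ne(1)], rule field_le_epsilon)
    fix p and \<epsilon> :: real assume p: "p \<in> distr ?S" and "0 < \<epsilon>"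
    from distr_range_tail[OF this] obtain N
      where N: "\<forall>P. (\<forall>i<N. P (s i)) \<longrightarrow> 1 - \<epsilon> \<le> prob_of ?S p P"
      by (rule exE)
    have "1 - \<epsilon> \<le> prob_of ?S p (\<lambda>x. \<not> \<pi> x (t N))" using \<pi> by (intro N[rule_format]) auto
    then have "prob_of ?S p (\<lambda>x. \<pi> x (t N)) \<le> \<epsilon>"
      using prob_of_not[OF p, of "\<lambda>x. \<pi> x (t N)"] by linarith
    then show "(INF q\<in>distr ?T. mix \<pi> ?S ?T p q) \<le> 0 + \<epsilon>"
      using INF_mix_le[OF p pure_distr[of "t N" ?T], of \<pi>] mix_pure_column[OF _ p, of "t N" ?T \<pi>]
      by simp
  qed
  moreover have "1 \<le> (INF q\<in>distr ?T. SUP p\<in>distr ?S. mix \<pi> ?S ?T p q)"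
  proof (rule cINF_greatest[OF ne(2)], rule field_le_epsilon)
    fix q and \<epsilon> :: real assume q: "q \<in> distr ?T" and "0 < \<epsilon>"
    from distr_range_tail[OF this] obtain N
      where N: "\<forall>P. (\<forall>i<N. P (t i)) \<longrightarrow> 1 - \<epsilon> \<le> prob_of ?T q P"
      by (rule exE)
    have "1 - \<epsilon> \<le> prob_of ?T q (\<pi> (s N))" using \<pi> by (intro N[rule_format]) auto
    then show "1 \<le> (SUP p\<in>distr ?S. mix \<pi> ?S ?T p q) + \<epsilon>"
      using le_SUP_mix[OF pure_distr[of "s N" ?S] q, of \<pi>] mix_pure_row[OF _ q, of "s N" ?S \<pi>]
      by simp
  qed
  ultimately show ?thesis by (simp add: minimax_property_def)
qed

theorem theorem3p1:
  fixes S :: "'a set" and T :: "'b set" and \<pi> :: "'a \<Rightarrow> 'b \<Rightarrow> bool"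
  assumes "S \<noteq> {}" and "T \<noteq> {}"
  shows "totally_minimax S T \<pi> \<longleftrightarrow> LNG_free S T \<pi>"
proof
  assume tot: "totally_minimax S T \<pi>"
  show "LNG_free S T \<pi>"
    unfolding LNG_free_def
  proof (intro notI, elim exE conjE)
    fix s :: "nat \<Rightarrow> 'a" and t :: "nat \<Rightarrow> 'b"
    assume "range s \<subseteq> S" "range t \<subseteq> T" and pat: "\<forall>i j. \<pi> (s i) (t j) \<longleftrightarrow> j \<le> i"
    then have "minimax_property (range s) (range t) \<pi>"
      using tot by (simp add: totally_minimax_def)
    then show False using LNG_not_minimax[of \<pi> s t] pat by blast
  qed
next
  assume "LNG_free S T \<pi>"
  then show "totally_minimax S T \<pi>"
    unfolding totally_minimax_def by (blast intro: LNG_free_imp_minimax LNG_free_subset)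
qed

end
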